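(* Let $\mathbf{k}$ be an integral domain with unity having more than two elements. Let $X=X_1\sqcup X_2\sqcup\cdots\sqcup X_n$ be the disjoint union (union quandle) of $n\ge 2$ quandles (if $X$ is finite, assume that $|X|$ is not invertible in $\mathbf{k}$). Then $\mathbf{k}[X]$ contains idempotents of the following form: (1) $\sum_{j=1}^n\alpha_ju_j$, where $u_j\in\mathbf{k}[X_j]$ is an idempotent with $\varepsilon(u_j)=1$ for each $j$, and $\alpha_1,\dots,\alpha_n\in\mathbf{k}$ satisfy $\sum_{i=1}^n\alpha_i=1$. (2) $\sum_{j=1}^nu_j$, where, for some index $i$, $u_i\in\mathbf{k}[X_i]$ is an idempotent with $\varepsilon(u_i)=1$, and $u_j\in\mathbf{k}[X_j]$ satisfies $u_j^2=0$ for each $j\ne i$. (3) $\sum_{j=1}^n\alpha_j\big(\sum_{x\in X_j}e_x\big)$, where $|X_j|<\infty$ for each $j$ and $\alpha_1,\dots,\alpha_n\in\mathbf{k}$ satisfy $\sum_{i=1}^n\alpha_i|X_i|=1$. That is, every element of one of these forms is an idempotent of $\mathbf{k}[X]$.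
   Context: A quandle is a non-empty set $X$ with a binary operation $*$ such that, for each $y\in X$, the map $x\mapsto x*y$ is an automorphism of $(X,* )$ fixing $y$. Given quandles $(X_i,*_i)$, the union quandle is the disjoint union $\sqcup_iX_i$ with $x*y=x*_iy$ if $x,y\in X_i$, and $x*y=x$ if $x\in X_i$, $y\in X_j$ with $i\ne j$. The quandle ring $\mathbf{k}[X]$ is the free $\mathbf{k}$-module with basis $\{e_x\mid x\in X\}$ with the (in general non-associative) $\mathbf{k}$-bilinear product determined by $e_xe_y=e_{x*y}$. The augmentation map is $\varepsilon:\mathbf{k}[X]\to\mathbf{k}$, $\varepsilon(\sum\alpha_xe_x)=\sum\alpha_x$. An idempotent is a non-zero $u$ with $u^2=u$. Each $\mathbf{k}[X_j]$ is viewed as a subring of $\mathbf{k}[X]$. *)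

theory Defs
  imports Main "HOL-Library.Poly_Mapping"
begin

definition magma_automorphism :: "'a set \<Rightarrow> ('a \<Rightarrow> 'a \<Rightarrow> 'a) \<Rightarrow> ('a \<Rightarrow> 'a) \<Rightarrow> bool" where
  "magma_automorphism X m f \<longleftrightarrow>
     bij_betw f X X \<and> (\<forall>x\<in>X. \<forall>z\<in>X. f (m x z) = m (f x) (f z))"

definition quandle :: "'a set \<Rightarrow> ('a \<Rightarrow> 'a \<Rightarrow> 'a) \<Rightarrow> bool" where
  "quandle X m \<longleftrightarrow>
     X \<noteq> {} \<and>
     (\<forall>x\<in>X. \<forall>y\<in>X. m x y \<in> X) \<and>
     (\<forall>y\<in>X. magma_automorphism X m (\<lambda>x. m x y) \<and> m y y = y)"

text \<open>The disjoint union of a family of quandles is formed externally, by tagging elements with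
  their index; the given carriers may overlap.\<close>

definition union_carrier :: "'i set \<Rightarrow> ('i \<Rightarrow> 'a set) \<Rightarrow> ('i \<times> 'a) set" where
  "union_carrier I X = Sigma I X"

definition union_op :: "('i \<Rightarrow> 'a \<Rightarrow> 'a \<Rightarrow> 'a) \<Rightarrow> 'i \<times> 'a \<Rightarrow> 'i \<times> 'a \<Rightarrow> 'i \<times> 'a" where
  "union_op m p q =
     (if fst p = fst q then (fst p, m (fst p) (snd p) (snd q)) else p)"

text \<open>The free module on a set X consists of the finitely supported functions whose support
  lies in X. The product below is not the convolution product that \<^theory>\<open>HOL-Library.Poly_Mapping\<close>
  provides when the basis is an additive monoid.\<close>

definition quandle_ring :: "'a set \<Rightarrow> ('a \<Rightarrow>\<^sub>0 'k::zero) set" where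
  "quandle_ring X = {u. Poly_Mapping.keys u \<subseteq> X}"

definition qbasis :: "'a \<Rightarrow> ('a \<Rightarrow>\<^sub>0 'k::comm_ring_1)" where
  "qbasis x = Poly_Mapping.single x 1"

definition qscale :: "'k::comm_ring_1 \<Rightarrow> ('a \<Rightarrow>\<^sub>0 'k) \<Rightarrow> ('a \<Rightarrow>\<^sub>0 'k)" where
  "qscale c u = Poly_Mapping.map (\<lambda>a. c * a) u"

definition qmult :: "('a \<Rightarrow> 'a \<Rightarrow> 'a) \<Rightarrow> ('a \<Rightarrow>\<^sub>0 'k::comm_ring_1) \<Rightarrow> ('a \<Rightarrow>\<^sub>0 'k) \<Rightarrow> ('a \<Rightarrow>\<^sub>0 'k)" where
  "qmult m u v =
     (\<Sum>x\<in>Poly_Mapping.keys u. \<Sum>y\<in>Poly_Mapping.keys v.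
        qscale (Poly_Mapping.lookup u x * Poly_Mapping.lookup v y) (qbasis (m x y)))"

definition augmentation :: "('a \<Rightarrow>\<^sub>0 'k::comm_ring_1) \<Rightarrow> 'k" where
  "augmentation u = (\<Sum>x\<in>Poly_Mapping.keys u. Poly_Mapping.lookup u x)"

definition qidempotent :: "'a set \<Rightarrow> ('a \<Rightarrow> 'a \<Rightarrow> 'a) \<Rightarrow> ('a \<Rightarrow>\<^sub>0 'k::comm_ring_1) \<Rightarrow> bool" where
  "qidempotent X m u \<longleftrightarrow> u \<in> quandle_ring X \<and> u \<noteq> 0 \<and> qmult m u u = u"

text \<open>The inclusion of the quandle ring of the component with index j into the quandle ring of
  the union quandle: the linear map sending the basis element of x to that of (j, x).\<close>

definition qembed :: "'i \<Rightarrow> ('a \<Rightarrow>\<^sub>0 'k::comm_ring_1) \<Rightarrow> ('i \<times> 'a \<Rightarrow>\<^sub>0 'k)" where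
  "qembed j u = (\<Sum>x\<in>Poly_Mapping.keys u. qscale (Poly_Mapping.lookup u x) (qbasis (j, x)))"

end

theory Submission
  imports Defs
begin

text \<open>If \<open>v\<^sub>j \<in> k[X\<^sub>j]\<close> satisfies \<open>v\<^sub>j\<^sup>2 = \<epsilon>(v\<^sub>j) v\<^sub>j\<close> for every \<open>j\<close>, then, because
  \<open>v\<^sub>i v\<^sub>j = \<epsilon>(v\<^sub>j) v\<^sub>i\<close> also holds for \<open>i \<noteq> j\<close> in the union quandle, the square of
  \<open>v = \<Sum>\<^sub>j v\<^sub>j\<close> is \<open>\<epsilon>(v) v\<close>. All three families consist of such sums with \<open>\<epsilon>(v) = 1\<close>;
  in the second one, \<open>u\<^sub>j\<^sup>2 = 0\<close> forces \<open>\<epsilon>(u\<^sub>j) = 0\<close> because \<open>k\<close> is a domain.\<close>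

section \<open>Scalar multiplication on the free module\<close>

lemma lookup_qscale [simp]:
  "Poly_Mapping.lookup (qscale c u) x = c * Poly_Mapping.lookup u x"
  by (simp add: qscale_def Poly_Mapping.map.rep_eq when_def)

lemma qscale_single [simp]:
  "qscale c (Poly_Mapping.single x a) = Poly_Mapping.single x (c * a)"
  by (rule poly_mapping_eqI) (simp add: lookup_single when_def)

lemma qscale_1 [simp]: "qscale 1 u = u"
  and qscale_0_left [simp]: "qscale 0 u = 0"
  and qscale_qscale: "qscale c (qscale d u) = qscale (c * d) u"
  and qscale_add: "qscale c (u + v) = qscale c u + qscale c v"
  and qscale_add_left: "qscale (c + d) u = qscale c u + qscale d u"
  by (rule poly_mapping_eqI; simp add: lookup_add algebra_simps)+

lemma qscale_0_right [simp]: "qscale c 0 = 0"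
  by (rule poly_mapping_eqI) simp

lemma qscale_sum: "qscale c (\<Sum>i\<in>I. f i) = (\<Sum>i\<in>I. qscale c (f i))"
  by (induction I rule: infinite_finite_induct) (simp_all add: qscale_add)

lemma qscale_sum_left: "qscale (\<Sum>i\<in>I. c i) u = (\<Sum>i\<in>I. qscale (c i) u)"
  by (induction I rule: infinite_finite_induct) (simp_all add: qscale_add_left)

section \<open>The augmentation map\<close>

text \<open>Supports vary under addition and scaling, so sums over exact supports are awkward to
  compare. Points outside the support contribute 0, which permits one common finite index set;
  \<open>qmult\<close> and \<open>qembed\<close> get the same device below.\<close>

lemma augmentation_superset:
  assumes "finite S" "Poly_Mapping.keys u \<subseteq> S"
  shows "augmentation u = (\<Sum>x\<in>S. Poly_Mapping.lookup u x)"
  unfolding augmentation_def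
  by (rule sum.mono_neutral_left) (use assms in \<open>auto simp: in_keys_iff\<close>)

lemma augmentation_single [simp]: "augmentation (Poly_Mapping.single x a) = a"
  by (simp add: augmentation_superset[of "{x}"])

lemma augmentation_0 [simp]: "augmentation 0 = 0"
  by (simp add: augmentation_def)

lemma augmentation_add: "augmentation (u + v) = augmentation u + augmentation v"
  by (simp add: augmentation_superset[of "Poly_Mapping.keys u \<union> Poly_Mapping.keys v"]
      Poly_Mapping.keys_add lookup_add sum.distrib)

lemma augmentation_sum: "augmentation (\<Sum>i\<in>I. f i) = (\<Sum>i\<in>I. augmentation (f i))"
  by (induction I rule: infinite_finite_induct) (simp_all add: augmentation_add)

lemma augmentation_qscale: "augmentation (qscale c u) = c * augmentation u"
proof -
  \<comment> \<open>Only an inclusion: scaling by 0 or by a zero divisor can shrink the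
    support.\<close>
  have "Poly_Mapping.keys (qscale c u) \<subseteq> Poly_Mapping.keys u"
    by (auto simp: in_keys_iff)
  then have "augmentation (qscale c u) =
      (\<Sum>x\<in>Poly_Mapping.keys u. Poly_Mapping.lookup (qscale c u) x)"
    by (intro augmentation_superset) simp_all
  then show ?thesis
    by (simp add: augmentation_def sum_distrib_left)
qed

section \<open>Bilinearity of the product\<close>

lemma qmult_superset:
  assumes "finite S" "Poly_Mapping.keys u \<subseteq> S" "finite T" "Poly_Mapping.keys v \<subseteq> T"
  shows "qmult m u v = (\<Sum>x\<in>S. \<Sum>y\<in>T.
    Poly_Mapping.single (m x y) (Poly_Mapping.lookup u x * Poly_Mapping.lookup v y))"
proof -
  have "qmult m u v = (\<Sum>x\<in>Poly_Mapping.keys u. \<Sum>y\<in>T.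
      Poly_Mapping.single (m x y) (Poly_Mapping.lookup u x * Poly_Mapping.lookup v y))"
    unfolding qmult_def qbasis_def qscale_single mult_1_right
    by (intro sum.cong refl sum.mono_neutral_left) (use assms in \<open>auto simp: in_keys_iff\<close>)
  also have "\<dots> = (\<Sum>x\<in>S. \<Sum>y\<in>T.
      Poly_Mapping.single (m x y) (Poly_Mapping.lookup u x * Poly_Mapping.lookup v y))"
    by (rule sum.mono_neutral_left) (use assms in \<open>auto simp: in_keys_iff\<close>)
  finally show ?thesis .
qed

lemma qmult_single [simp]:
  "qmult m (Poly_Mapping.single x a) (Poly_Mapping.single y b) = Poly_Mapping.single (m x y) (a * b)"
  by (simp add: qmult_superset[of "{x}" _ "{y}"])

lemma qmult_0_left [simp]: "qmult m 0 v = 0"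
  and qmult_0_right [simp]: "qmult m u 0 = 0"
  by (simp_all add: qmult_def)

lemma qmult_add_left: "qmult m (u + u') v = qmult m u v + qmult m u' v"
  by (simp add: qmult_superset[of "Poly_Mapping.keys u \<union> Poly_Mapping.keys u'" _ "Poly_Mapping.keys v"]
      Poly_Mapping.keys_add lookup_add distrib_right single_add sum.distrib)

lemma qmult_add_right: "qmult m u (v + v') = qmult m u v + qmult m u v'"
  by (simp add: qmult_superset[of "Poly_Mapping.keys u" _ "Poly_Mapping.keys v \<union> Poly_Mapping.keys v'"]
      Poly_Mapping.keys_add lookup_add distrib_left single_add sum.distrib)

lemma qmult_sum_left: "qmult m (\<Sum>i\<in>I. f i) v = (\<Sum>i\<in>I. qmult m (f i) v)"
  by (induction I rule: infinite_finite_induct) (simp_all add: qmult_add_left)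

lemma qmult_sum_right: "qmult m u (\<Sum>i\<in>I. f i) = (\<Sum>i\<in>I. qmult m u (f i))"
  by (induction I rule: infinite_finite_induct) (simp_all add: qmult_add_right)

text \<open>Every element is the finite sum of its monomials. Identities additive in each argument
  therefore reduce to monomials, where the product is just \<open>m\<close> on basis
  indices.\<close>

lemma poly_mapping_single_induct [case_names zero single add]:
  fixes u :: "'a \<Rightarrow>\<^sub>0 'k::comm_monoid_add"
  assumes "P 0" "\<And>x a. P (Poly_Mapping.single x a)" "\<And>u v. P u \<Longrightarrow> P v \<Longrightarrow> P (u + v)"
  shows "P u"
proof -
  have "P (\<Sum>x\<in>S. Poly_Mapping.single x (Poly_Mapping.lookup u x))" for S
    by (induction S rule: infinite_finite_induct) (simp_all add: assms)
  moreover have "u = (\<Sum>x\<in>Poly_Mapping.keys u. Poly_Mapping.single x (Poly_Mapping.lookup u x))"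
    by (rule poly_mapping_eqI)
      (simp add: lookup_sum lookup_single when_def in_keys_iff)
  ultimately show ?thesis
    by metis
qed

lemma qmult_qscale: "qmult m (qscale c u) (qscale d v) = qscale (c * d) (qmult m u v)"
proof (induction u rule: poly_mapping_single_induct)
  case (single x a)
  show ?case
    by (induction v rule: poly_mapping_single_induct)
      (simp_all add: qmult_add_right qscale_add mult_ac)
qed (simp_all add: qmult_add_left qscale_add)

text \<open>Both sides are biadditive, and on monomials with coefficients a and b both equal a * b,
  whatever the operation \<open>m\<close>.\<close>

lemma augmentation_qmult: "augmentation (qmult m u v) = augmentation u * augmentation v"
proof (induction u rule: poly_mapping_single_induct)
  case (single x a)
  show ?case
    by (induction v rule: poly_mapping_single_induct)
      (simp_all add: qmult_add_right augmentation_add distrib_left)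
qed (simp_all add: qmult_add_left augmentation_add distrib_right)

section \<open>The embeddings of the component rings into the ring of the union\<close>

lemma qembed_superset:
  assumes "finite S" "Poly_Mapping.keys u \<subseteq> S"
  shows "qembed j u = (\<Sum>x\<in>S. Poly_Mapping.single (j, x) (Poly_Mapping.lookup u x))"
  unfolding qembed_def qbasis_def qscale_single mult_1_right
  by (rule sum.mono_neutral_left) (use assms in \<open>auto simp: in_keys_iff\<close>)

lemma qembed_single [simp]:
  "qembed j (Poly_Mapping.single x a) = Poly_Mapping.single (j, x) a"
  by (simp add: qembed_superset[of "{x}"])

lemma qembed_0 [simp]: "qembed j 0 = 0"
  by (simp add: qembed_def)

lemma qembed_add: "qembed j (u + v) = qembed j u + qembed j v"
  by (simp add: qembed_superset[of "Poly_Mapping.keys u \<union> Poly_Mapping.keys v"]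
      Poly_Mapping.keys_add lookup_add single_add sum.distrib)

lemma qembed_sum: "qembed j (\<Sum>i\<in>I. f i) = (\<Sum>i\<in>I. qembed j (f i))"
  by (induction I rule: infinite_finite_induct) (simp_all add: qembed_add)

lemma qembed_qscale: "qembed j (qscale c u) = qscale c (qembed j u)"
  by (induction u rule: poly_mapping_single_induct) (simp_all add: qscale_add qembed_add)

lemma augmentation_qembed [simp]: "augmentation (qembed j u) = augmentation u"
  by (induction u rule: poly_mapping_single_induct) (simp_all add: augmentation_add qembed_add)

text \<open>On pairs with the common tag \<open>j\<close>, \<open>union_op m\<close> acts as
  \<open>m j\<close>; this makes each component ring a subring.\<close>

lemma qmult_qembed_same:
  "qmult (union_op m) (qembed j u) (qembed j v) = qembed j (qmult (m j) u v)"
proof (induction u rule: poly_mapping_single_induct)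
  case (single x a)
  show ?case
    by (induction v rule: poly_mapping_single_induct)
      (simp_all add: qmult_add_right qembed_add union_op_def)
qed (simp_all add: qmult_add_left qembed_add)

text \<open>A basis element of another component acts trivially from the right, so a monomial with
  coefficient b multiplies by the scalar b, and \<open>v\<close> by the sum of its
  coefficients.\<close>

lemma qmult_qembed_distinct:
  assumes "i \<noteq> j"
  shows "qmult (union_op m) (qembed i u) (qembed j v) = qscale (augmentation v) (qembed i u)"
proof (induction u rule: poly_mapping_single_induct)
  case (single x a)
  show ?case
    by (induction v rule: poly_mapping_single_induct)
      (use assms in \<open>simp_all add: qmult_add_right qembed_add augmentation_add union_op_def
        distrib_left single_add mult.commute\<close>)
qed (simp_all add: qmult_add_left qembed_add qscale_add)

section \<open>Membership in the quandle ring\<close>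

lemma quandle_ring_sum:
  "(\<And>i. i \<in> I \<Longrightarrow> f i \<in> quandle_ring X) \<Longrightarrow> (\<Sum>i\<in>I. f i) \<in> quandle_ring X"
  using Poly_Mapping.keys_sum[of f I] unfolding quandle_ring_def by blast

lemma quandle_ring_single: "x \<in> X \<Longrightarrow> Poly_Mapping.single x a \<in> quandle_ring X"
  by (simp add: quandle_ring_def)

lemma quandle_ring_qscale: "u \<in> quandle_ring X \<Longrightarrow> qscale c u \<in> quandle_ring X"
  unfolding quandle_ring_def by (auto simp: in_keys_iff subset_iff dest: mult_not_zero)

lemma qembed_in_quandle_ring:
  assumes "j \<in> I" "u \<in> quandle_ring (X j)"
  shows "qembed j u \<in> quandle_ring (union_carrier I X)"
  unfolding qembed_def qbasis_def
  by (intro quandle_ring_sum) (use assms in \<open>auto simp: union_carrier_def quandle_ring_def\<close>)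

section \<open>The common criterion for idempotents of the union\<close>

lemma qidempotent_union_sum:
  fixes v :: "'i \<Rightarrow> 'a \<Rightarrow>\<^sub>0 'k::comm_ring_1"
  assumes v: "\<And>j. j \<in> I \<Longrightarrow> v j \<in> quandle_ring (X j)"
    and sq: "\<And>j. j \<in> I \<Longrightarrow> qmult (m j) (v j) (v j) = qscale (augmentation (v j)) (v j)"
    and aug: "(\<Sum>j\<in>I. augmentation (v j)) = 1"
  shows "qidempotent (union_carrier I X) (union_op m) (\<Sum>j\<in>I. qembed j (v j))"
proof -
  let ?w = "\<Sum>j\<in>I. qembed j (v j)"
  have "qmult (union_op m) (qembed i (v i)) (qembed j (v j))
      = qscale (augmentation (v j)) (qembed i (v i))" if "i \<in> I" for i j
    using sq[OF that]
    by (cases "i = j") (simp_all add: qmult_qembed_same qmult_qembed_distinct qembed_qscale)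
  \<comment> \<open>Expanding the left factor first keeps \<open>i\<close> as the outer index; the
    inner sum over \<open>j\<close> then collects the augmentations into a single scalar, which is 1
    by \<open>aug\<close>.\<close>
  then have "qmult (union_op m) ?w ?w
      = (\<Sum>i\<in>I. \<Sum>j\<in>I. qscale (augmentation (v j)) (qembed i (v i)))"
    unfolding qmult_sum_left unfolding qmult_sum_right by simp
  also have "\<dots> = ?w"
    by (simp only: aug qscale_1 flip: qscale_sum_left)
  finally have "qmult (union_op m) ?w ?w = ?w" .
  \<comment> \<open>Nonvanishing is read off from the augmentation, as 0 has augmentation 0.\<close>
  moreover have "augmentation ?w = 1"
    by (simp add: augmentation_sum aug)
  then have "?w \<noteq> 0"
    by auto
  moreover have "?w \<in> quandle_ring (union_carrier I X)"
    by (intro quandle_ring_sum qembed_in_quandle_ring v)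
  ultimately show ?thesis
    by (simp add: qidempotent_def)
qed

text \<open>Right translation by each y in \<open>X\<close> permutes \<open>X\<close>, so the sum s
  of the basis elements satisfies s e_y = s; summing over y gives |X| s. For infinite
  \<open>X\<close> the sum and the cardinality both default to 0.\<close>

lemma qmult_sum_basis_self:
  assumes "quandle X m"
  shows "qmult m (\<Sum>x\<in>X. qbasis x) (\<Sum>x\<in>X. qbasis x) =
    qscale (of_nat (card X)) (\<Sum>x\<in>X. qbasis x :: 'a \<Rightarrow>\<^sub>0 'k::comm_ring_1)"
proof -
  let ?e = "\<lambda>x. qbasis x :: 'a \<Rightarrow>\<^sub>0 'k"
  have "(\<Sum>x\<in>X. ?e (m x y)) = (\<Sum>x\<in>X. ?e x)" if "y \<in> X" for y
    using assms that unfolding quandle_def magma_automorphism_def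
    by (intro sum.reindex_bij_betw) blast
  \<comment> \<open>The factor \<open>qscale 1\<close> exposes a scalar in each summand, so that
    \<open>qscale_sum_left\<close> can gather them into the cardinality.\<close>
  then have "(\<Sum>y\<in>X. \<Sum>x\<in>X. ?e (m x y)) = (\<Sum>y\<in>X. qscale 1 (\<Sum>x\<in>X. ?e x))"
    by simp
  also have "\<dots> = qscale (of_nat (card X)) (\<Sum>x\<in>X. ?e x)"
    unfolding qscale_sum_left[symmetric] by simp
  finally have "(\<Sum>y\<in>X. \<Sum>x\<in>X. ?e (m x y)) = qscale (of_nat (card X)) (\<Sum>x\<in>X. ?e x)" .
  then show ?thesis
    unfolding qmult_sum_right qmult_sum_left by (simp add: qbasis_def)
qed

section \<open>The three families of idempotents\<close>

theorem proposition6p1: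
  fixes n :: nat
    and X :: "nat \<Rightarrow> 'a set"
    and m :: "nat \<Rightarrow> 'a \<Rightarrow> 'a \<Rightarrow> 'a"
  assumes k_card: "infinite (UNIV :: 'k::idom set) \<or> card (UNIV :: 'k set) > 2"
    and n: "n \<ge> 2"
    and quandles: "\<And>j. j \<in> {1..n} \<Longrightarrow> quandle (X j) (m j)"
    and card_not_unit: "finite (union_carrier {1..n} X) \<Longrightarrow>
          \<not> (of_nat (card (union_carrier {1..n} X)) dvd (1 :: 'k))"
  shows
    "(\<forall>(\<alpha> :: nat \<Rightarrow> 'k) (u :: nat \<Rightarrow> 'a \<Rightarrow>\<^sub>0 'k).
        (\<forall>j\<in>{1..n}. qidempotent (X j) (m j) (u j) \<and> augmentation (u j) = 1) \<and>
        (\<Sum>i=1..n. \<alpha> i) = 1 \<longrightarrow>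
        qidempotent (union_carrier {1..n} X) (union_op m)
          (\<Sum>j=1..n. qscale (\<alpha> j) (qembed j (u j)))) \<and>
     (\<forall>(u :: nat \<Rightarrow> 'a \<Rightarrow>\<^sub>0 'k).
        (\<exists>i\<in>{1..n}. qidempotent (X i) (m i) (u i) \<and> augmentation (u i) = 1 \<and>
           (\<forall>j\<in>{1..n} - {i}. u j \<in> quandle_ring (X j) \<and> qmult (m j) (u j) (u j) = 0)) \<longrightarrow>
        qidempotent (union_carrier {1..n} X) (union_op m)
          (\<Sum>j=1..n. qembed j (u j))) \<and>
     (\<forall>(\<alpha> :: nat \<Rightarrow> 'k).
        (\<forall>j\<in>{1..n}. finite (X j)) \<and>
        (\<Sum>i=1..n. \<alpha> i * of_nat (card (X i))) = 1 \<longrightarrow>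
        qidempotent (union_carrier {1..n} X) (union_op m)
          (\<Sum>j=1..n. qscale (\<alpha> j) (\<Sum>x\<in>X j. qembed j (qbasis x))))"
proof (intro conjI allI impI)
  fix \<alpha> :: "nat \<Rightarrow> 'k" and u :: "nat \<Rightarrow> 'a \<Rightarrow>\<^sub>0 'k"
  assume *: "(\<forall>j\<in>{1..n}. qidempotent (X j) (m j) (u j) \<and> augmentation (u j) = 1) \<and>
    (\<Sum>i=1..n. \<alpha> i) = 1"
  \<comment> \<open>The criterion is applied to v_j = \<alpha>_j u_j: since u_j has augmentation 1,
    v_j has augmentation \<alpha>_j, and its square \<alpha>_j^2 u_j is \<alpha>_j v_j.\<close>
  have "qidempotent (union_carrier {1..n} X) (union_op m)
      (\<Sum>j=1..n. qembed j (qscale (\<alpha> j) (u j)))"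
    by (rule qidempotent_union_sum)
      (use * in \<open>auto simp: qidempotent_def quandle_ring_qscale qmult_qscale augmentation_qscale
        qscale_qscale\<close>)
  then show "qidempotent (union_carrier {1..n} X) (union_op m)
      (\<Sum>j=1..n. qscale (\<alpha> j) (qembed j (u j)))"
    by (simp add: qembed_qscale)
next
  fix u :: "nat \<Rightarrow> 'a \<Rightarrow>\<^sub>0 'k"
  assume "\<exists>i\<in>{1..n}. qidempotent (X i) (m i) (u i) \<and> augmentation (u i) = 1 \<and>
    (\<forall>j\<in>{1..n} - {i}. u j \<in> quandle_ring (X j) \<and> qmult (m j) (u j) (u j) = 0)"
  then obtain i where i: "i \<in> {1..n}" "qidempotent (X i) (m i) (u i)" "augmentation (u i) = 1"
    and nil: "\<And>j. j \<in> {1..n} - {i} \<Longrightarrow> u j \<in> quandle_ring (X j) \<and> qmult (m j) (u j) (u j) = 0"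
    by blast
  have aug: "augmentation (u j) = 0" if "j \<in> {1..n} - {i}" for j
    using augmentation_qmult[of "m j" "u j" "u j"] nil[OF that] by simp
  show "qidempotent (union_carrier {1..n} X) (union_op m) (\<Sum>j=1..n. qembed j (u j))"
  proof (rule qidempotent_union_sum)
    fix j assume j: "j \<in> {1..n}"
    show "u j \<in> quandle_ring (X j)"
      using i nil[of j] j by (cases "j = i") (auto simp: qidempotent_def)
    \<comment> \<open>The scalar is 1 at \<open>j = i\<close>, where \<open>u i\<close> is
      idempotent; at every other index it is 0 and both sides vanish.\<close>
    show "qmult (m j) (u j) (u j) = qscale (augmentation (u j)) (u j)"
      using i nil[of j] aug[of j] j by (cases "j = i") (auto simp: qidempotent_def)
  next
    show "(\<Sum>j=1..n. augmentation (u j)) = 1"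
      using i aug by (simp add: sum.remove[of _ i])
  qed
next
  fix \<alpha> :: "nat \<Rightarrow> 'k"
  assume *: "(\<forall>j\<in>{1..n}. finite (X j)) \<and> (\<Sum>i=1..n. \<alpha> i * of_nat (card (X i))) = 1"
  define s where "s j = (\<Sum>x\<in>X j. qbasis x :: 'a \<Rightarrow>\<^sub>0 'k)" for j
  \<comment> \<open>These hold for every \<open>j\<close>: if \<open>X j\<close> is infinite,
    \<open>s j\<close> and \<open>card (X j)\<close> are 0 by default.\<close>
  have s: "s j \<in> quandle_ring (X j)" "augmentation (s j) = of_nat (card (X j))" for j
    by (auto simp: s_def qbasis_def augmentation_sum intro!: quandle_ring_sum quandle_ring_single)
  have "qmult (m j) (s j) (s j) = qscale (of_nat (card (X j))) (s j)" if "j \<in> {1..n}" for j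
    unfolding s_def by (rule qmult_sum_basis_self) (rule quandles[OF that])
  \<comment> \<open>Here v_j = \<alpha>_j s_j has augmentation \<alpha>_j |X_j|, and its square
    \<alpha>_j^2 |X_j| s_j is exactly that scalar times v_j.\<close>
  then have "qidempotent (union_carrier {1..n} X) (union_op m)
      (\<Sum>j=1..n. qembed j (qscale (\<alpha> j) (s j)))"
    by (intro qidempotent_union_sum)
      (use * s in \<open>auto simp: quandle_ring_qscale qmult_qscale augmentation_qscale qscale_qscale
        mult_ac\<close>)
  then show "qidempotent (union_carrier {1..n} X) (union_op m)
      (\<Sum>j=1..n. qscale (\<alpha> j) (\<Sum>x\<in>X j. qembed j (qbasis x)))"
    by (simp add: qembed_qscale s_def qembed_sum)
qed

end
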